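(* Let $P\in S^3((k^2)^* )$ with $Q_n(P)\neq0$. Then $P$ is in the image of $\Psi:S^3((k^2)^* )\to S^3((k^2)^* )$ if and only if $9Q_n(P)$ is a cube in $k^*$.
   Context: $k$ is a field of characteristic different from $2$ and $3$; $x,y$ is the standard coordinate basis of $(k^2)^*$; $S^3((k^2)^* )=\{ax^3+3bx^2y+3cxy^2+dy^3: a,b,c,d\in k\}$ is the space of binary cubics. For $P=ax^3+3bx^2y+3cxy^2+dy^3$ set $\alpha=ad-bc$, $\beta=2(bd-c^2)$, $\gamma=2(b^2-ac)$. Then $$\Psi(P)=(-3a\alpha-3b\gamma)x^3+(-3a\beta-3b\alpha-6c\gamma)x^2y+(-6b\beta+3c\alpha-3d\gamma)xy^2+(-3c\beta+3d\alpha)y^3$$ and $Q_n(P)=\alpha^2+\beta\gamma=a^2d^2-3b^2c^2-6abcd+4b^3d+4ac^3$. *)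

theory Defs
  imports "HOL-Computational_Algebra.Polynomial"
begin

text \<open>
  Bivariate polynomials over \<open>k\<close> are rendered as \<open>k[x][y]\<close>: the outer variable is \<open>y\<close>, the
  inner one \<open>x\<close>, so the coefficient of \<open>x\<^sup>i y\<^sup>j\<close> in \<open>P\<close> is \<open>coeff (coeff P j) i\<close>.
\<close>

definition X :: "'a::comm_ring_1 poly poly" where
  "X = [:[:0, 1:]:]"

definition Y :: "'a::comm_ring_1 poly poly" where
  "Y = [:0, 1:]"

abbreviation const :: "'a::comm_ring_1 \<Rightarrow> 'a poly poly" where
  "const a \<equiv> [:[:a:]:]"

definition binary_cubics :: "'a::field poly poly set" where
  "binary_cubics =
     {const a * X^3 + const (3 * b) * X^2 * Y + const (3 * c) * X * Y^2 + const d * Y^3 | a b c d. True}"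

text \<open>
  The coordinates \<open>a, b, c, d\<close> of \<open>P = a x\<^sup>3 + 3 b x\<^sup>2 y + 3 c x y\<^sup>2 + d y\<^sup>3\<close>; the divisions by 3
  are meaningful because the characteristic is never 3 where these are used.
\<close>

definition cf_a :: "'a::field poly poly \<Rightarrow> 'a" where
  "cf_a P = coeff (coeff P 0) 3"

definition cf_b :: "'a::field poly poly \<Rightarrow> 'a" where
  "cf_b P = coeff (coeff P 1) 2 / 3"

definition cf_c :: "'a::field poly poly \<Rightarrow> 'a" where
  "cf_c P = coeff (coeff P 2) 1 / 3"

definition cf_d :: "'a::field poly poly \<Rightarrow> 'a" where
  "cf_d P = coeff (coeff P 3) 0"

definition alpha :: "'a::field poly poly \<Rightarrow> 'a" where
  "alpha P = cf_a P * cf_d P - cf_b P * cf_c P"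

definition beta :: "'a::field poly poly \<Rightarrow> 'a" where
  "beta P = 2 * (cf_b P * cf_d P - (cf_c P)^2)"

definition gamma :: "'a::field poly poly \<Rightarrow> 'a" where
  "gamma P = 2 * ((cf_b P)^2 - cf_a P * cf_c P)"

definition Psi :: "'a::field poly poly \<Rightarrow> 'a poly poly" where
  "Psi P =
     (let a = cf_a P; b = cf_b P; c = cf_c P; d = cf_d P;
          \<alpha> = alpha P; \<beta> = beta P; \<gamma> = gamma P
      in const (- 3 * a * \<alpha> - 3 * b * \<gamma>) * X^3
       + const (- 3 * a * \<beta> - 3 * b * \<alpha> - 6 * c * \<gamma>) * X^2 * Y
       + const (- 6 * b * \<beta> + 3 * c * \<alpha> - 3 * d * \<gamma>) * X * Y^2
       + const (- 3 * c * \<beta> + 3 * d * \<alpha>) * Y^3)"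

definition Q\<^sub>n :: "'a::field poly poly \<Rightarrow> 'a" where
  "Q\<^sub>n P = (alpha P)^2 + beta P * gamma P"

lemma coeff_cubic:
  fixes p q r s :: "'a::field"
  defines "P \<equiv> const p * X^3 + const q * X^2 * Y + const r * X * Y^2 + const s * Y^3"
  shows "coeff (coeff P 0) 3 = p" "coeff (coeff P 1) 2 = q"
    "coeff (coeff P 2) 1 = r" "coeff (coeff P 3) 0 = s"
  unfolding P_def X_def Y_def
  by (simp_all add: numeral_2_eq_2 numeral_3_eq_3)

lemma cf_cubic:
  fixes a b c d :: "'a::field"
  assumes "CHAR('a) \<noteq> 3"
  defines "P \<equiv> const a * X^3 + const (3 * b) * X^2 * Y + const (3 * c) * X * Y^2 + const d * Y^3"
  shows "cf_a P = a" "cf_b P = b" "cf_c P = c" "cf_d P = d"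
proof -
  have "(3::'a) \<noteq> 0"
  proof
    assume "(3::'a) = 0"
    then have "CHAR('a) dvd 3"
      using of_nat_eq_0_iff_char_dvd[of 3, where 'a = 'a] by simp
    moreover have "CHAR('a) \<noteq> 1"
      by (metis of_nat_1 of_nat_CHAR zero_neq_one)
    moreover have "m = 1 \<or> m = 3" if "m dvd 3" for m :: nat
    proof -
      have "m \<le> 3" using that by (simp add: dvd_imp_le)
      then have "m \<in> {0, 1, 2, 3}" by auto
      then show ?thesis using that by auto
    qed
    ultimately show False
      using assms(1) by blast
  qed
  then show "cf_a P = a" "cf_b P = b" "cf_c P = c" "cf_d P = d"
    unfolding P_def cf_a_def cf_b_def cf_c_def cf_d_def
    by (simp_all only: coeff_cubic) simp_all
qed

lemma Q\<^sub>n_expand: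
  fixes P :: "'a::field poly poly"
  defines "a \<equiv> cf_a P" and "b \<equiv> cf_b P" and "c \<equiv> cf_c P" and "d \<equiv> cf_d P"
  shows "Q\<^sub>n P = a^2 * d^2 - 3 * b^2 * c^2 - 6 * a * b * c * d + 4 * b^3 * d + 4 * a * c^3"
  unfolding Q\<^sub>n_def alpha_def beta_def gamma_def a_def b_def c_def d_def
  by (simp add: algebra_simps power2_eq_square power3_eq_cube)

lemma Psi_in_binary_cubics:
  fixes P :: "'a::field poly poly"
  shows "Psi P \<in> binary_cubics"
proof -
  let ?a = "cf_a P" and ?b = "cf_b P" and ?c = "cf_c P" and ?d = "cf_d P"
  have eqs: "- 3 * ?a * beta P - 3 * ?b * alpha P - 6 * ?c * gamma P
      = 3 * (- ?a * beta P - ?b * alpha P - 2 * ?c * gamma P)"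
    "- 6 * ?b * beta P + 3 * ?c * alpha P - 3 * ?d * gamma P
      = 3 * (- 2 * ?b * beta P + ?c * alpha P - ?d * gamma P)"
    by (simp_all add: algebra_simps)
  show ?thesis
    unfolding Psi_def Let_def binary_cubics_def eqs by blast
qed

end

theory Submission
  imports Defs
begin

text \<open>
  The triple \<open>(\<alpha>, \<beta>, \<gamma>)\<close> attached to \<open>P\<close> is an element \<open>\<mu>(P)\<close> of \<open>sl\<^sub>2\<close>, depending
  quadratically on \<open>P\<close>; \<open>Q\<^sub>n P\<close> is minus its determinant, and \<open>\<Psi>(P) = \<mu>(P) \<cdot> P\<close> for the action
  of \<open>sl\<^sub>2\<close> on binary cubics. Two facts about this action decide everything:

  \<^item> \<open>\<mu>(\<Psi>(P)) = -9 Q\<^sub>n(P) \<mu>(P)\<close>, that is, the quadratic covariant of the cubic covariant is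
    proportional to that of \<open>P\<close> (lemma \<open>moment_Psi\<close>);
  \<^item> \<open>\<mu>(P) \<cdot> \<mu>(P) \<cdot> P = 9 Q\<^sub>n(P) P\<close>. If \<open>Q\<^sub>n(P) \<noteq> 0\<close>, then over an extension field \<open>P\<close> is a sum
    of cubes of two eigenvectors of \<open>\<mu>(P)\<close>, on which \<open>\<mu>(P)\<close> acts by \<open>\<plusminus>3 \<surd>(Q\<^sub>n(P))\<close>.

  Taking minus the determinant in the first fact gives \<open>Q\<^sub>n(\<Psi>(P)) = 81 Q\<^sub>n(P)\<^sup>3\<close>
  (lemma \<open>Qn_Psi\<close>), hence \<open>9 Q\<^sub>n(\<Psi>(P)) = (9 Q\<^sub>n(P))\<^sup>3\<close>, so the condition is necessary.
  The two facts together give \<open>\<Psi>(\<Psi>(P)) = -81 Q\<^sub>n(P)\<^sup>2 P\<close> (lemma \<open>Psi_Psi\<close>). Since \<open>\<Psi>\<close> is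
  homogeneous of degree 3, a suitable multiple of \<open>\<Psi>(P)\<close> is a preimage of \<open>P\<close> as soon as
  \<open>81 Q\<^sub>n(P)\<^sup>2\<close> is a cube, which it is when \<open>9 Q\<^sub>n(P)\<close> is one.
\<close>

lemma binary_cubic_eq:
  fixes P :: "'a::field poly poly"
  assumes "CHAR('a) \<noteq> 3" and "P \<in> binary_cubics"
  shows "P = const (cf_a P) * X^3 + const (3 * cf_b P) * X^2 * Y
           + const (3 * cf_c P) * X * Y^2 + const (cf_d P) * Y^3"
proof -
  obtain a b c d where
    "P = const a * X^3 + const (3 * b) * X^2 * Y + const (3 * c) * X * Y^2 + const d * Y^3"
    using assms(2) unfolding binary_cubics_def by blast
  with cf_cubic[OF assms(1), of a b c d] show ?thesis by simp
qed

lemma const_times_cubic: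
  fixes l :: "'a::comm_ring_1"
  shows "const l * (const p * X^3 + const q * X^2 * Y + const r * X * Y^2 + const s * Y^3)
       = const (l * p) * X^3 + const (l * q) * X^2 * Y + const (l * r) * X * Y^2 + const (l * s) * Y^3"
proof -
  have const_mult: "const (l * u) = const l * const u" for u by simp
  show ?thesis unfolding const_mult by (simp only: distrib_left mult.assoc)
qed

lemma cf_scale:
  "cf_a (const l * P) = l * cf_a P" "cf_b (const l * P) = l * cf_b P"
  "cf_c (const l * P) = l * cf_c P" "cf_d (const l * P) = l * cf_d P"
  by (simp_all add: cf_a_def cf_b_def cf_c_def cf_d_def)

lemma scale_in_binary_cubics:
  assumes "P \<in> binary_cubics"
  shows "const l * P \<in> binary_cubics"
proof -
  obtain a b c d where
    P: "P = const a * X^3 + const (3 * b) * X^2 * Y + const (3 * c) * X * Y^2 + const d * Y^3"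
    using assms unfolding binary_cubics_def by blast
  have "const l * P = const (l * a) * X^3 + const (3 * (l * b)) * X^2 * Y
      + const (3 * (l * c)) * X * Y^2 + const (l * d) * Y^3"
    unfolding P const_times_cubic by (simp only: mult.left_commute)
  then show ?thesis unfolding binary_cubics_def by blast
qed

lemma moment_scale:
  "alpha (const l * P) = l^2 * alpha P" "beta (const l * P) = l^2 * beta P"
  "gamma (const l * P) = l^2 * gamma P"
  unfolding alpha_def beta_def gamma_def cf_scale by algebra+

lemma Psi_scale: "Psi (const l * P) = const (l^3) * Psi P"
proof -
  have coeffs:
    "- 3 * (l * a) * (l^2 * \<alpha>) - 3 * (l * b) * (l^2 * \<gamma>) = l^3 * (- 3 * a * \<alpha> - 3 * b * \<gamma>)"
    "- 3 * (l * a) * (l^2 * \<beta>) - 3 * (l * b) * (l^2 * \<alpha>) - 6 * (l * c) * (l^2 * \<gamma>)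
       = l^3 * (- 3 * a * \<beta> - 3 * b * \<alpha> - 6 * c * \<gamma>)"
    "- 6 * (l * b) * (l^2 * \<beta>) + 3 * (l * c) * (l^2 * \<alpha>) - 3 * (l * d) * (l^2 * \<gamma>)
       = l^3 * (- 6 * b * \<beta> + 3 * c * \<alpha> - 3 * d * \<gamma>)"
    "- 3 * (l * c) * (l^2 * \<beta>) + 3 * (l * d) * (l^2 * \<alpha>) = l^3 * (- 3 * c * \<beta> + 3 * d * \<alpha>)"
    for a b c d \<alpha> \<beta> \<gamma>
    by algebra+
  show ?thesis
    unfolding Psi_def Let_def cf_scale moment_scale coeffs(2)
    unfolding coeffs(1,3,4) const_times_cubic ..
qed

lemma cf_Psi:
  fixes P :: "'a::field poly poly"
  assumes "CHAR('a) \<noteq> 3"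
  shows "cf_a (Psi P) = - 3 * (cf_a P * alpha P + cf_b P * gamma P)"
    and "cf_b (Psi P) = - (cf_a P * beta P + cf_b P * alpha P + 2 * cf_c P * gamma P)"
    and "cf_c (Psi P) = - 2 * cf_b P * beta P + cf_c P * alpha P - cf_d P * gamma P"
    and "cf_d (Psi P) = 3 * (cf_d P * alpha P - cf_c P * beta P)"
proof -
  let ?a' = "- 3 * (cf_a P * alpha P + cf_b P * gamma P)"
  let ?b' = "- (cf_a P * beta P + cf_b P * alpha P + 2 * cf_c P * gamma P)"
  let ?c' = "- 2 * cf_b P * beta P + cf_c P * alpha P - cf_d P * gamma P"
  let ?d' = "3 * (cf_d P * alpha P - cf_c P * beta P)"
  have coeffs:
    "- 3 * cf_a P * alpha P - 3 * cf_b P * gamma P = ?a'"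
    "- 3 * cf_a P * beta P - 3 * cf_b P * alpha P - 6 * cf_c P * gamma P = 3 * ?b'"
    "- 6 * cf_b P * beta P + 3 * cf_c P * alpha P - 3 * cf_d P * gamma P = 3 * ?c'"
    "- 3 * cf_c P * beta P + 3 * cf_d P * alpha P = ?d'"
    by algebra+
  have Psi_eq: "Psi P = const ?a' * X^3 + const (3 * ?b') * X^2 * Y
                      + const (3 * ?c') * X * Y^2 + const ?d' * Y^3"
    unfolding Psi_def Let_def coeffs ..
  show "cf_a (Psi P) = ?a'" "cf_b (Psi P) = ?b'" "cf_c (Psi P) = ?c'" "cf_d (Psi P) = ?d'"
    unfolding Psi_eq by (rule cf_cubic[OF assms])+
qed

text \<open>
  Up to factors, \<open>(\<alpha>, \<beta>, \<gamma>)\<close> are the coefficients of the Hessian of \<open>P\<close>, and \<open>\<Psi>(P)\<close> is the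
  Jacobian of \<open>P\<close> and its Hessian. For \<open>P = x\<^sup>3 + y\<^sup>3\<close> one has \<open>\<Psi>(P) = -3 x\<^sup>3 + 3 y\<^sup>3\<close>, and both
  Hessians are multiples of \<open>x y\<close>, which yields the factor \<open>-9\<close>; a generic cubic reduces to
  this one by a linear change of variables over an extension field. In coordinates the claim
  is an identity of polynomials of degree 6.
\<close>
lemma moment_Psi:
  fixes P :: "'a::field poly poly"
  assumes "CHAR('a) \<noteq> 3"
  shows "alpha (Psi P) = - 9 * Q\<^sub>n P * alpha P"
    and "beta (Psi P) = - 9 * Q\<^sub>n P * beta P"
    and "gamma (Psi P) = - 9 * Q\<^sub>n P * gamma P"
  unfolding alpha_def[of "Psi P"] beta_def[of "Psi P"] gamma_def[of "Psi P"] cf_Psi[OF assms]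
  unfolding Q\<^sub>n_def alpha_def beta_def gamma_def
  by algebra+

lemma Qn_Psi:
  fixes P :: "'a::field poly poly"
  assumes "CHAR('a) \<noteq> 3"
  shows "Q\<^sub>n (Psi P) = 81 * Q\<^sub>n P ^ 3"
proof -
  have "Q\<^sub>n (Psi P) = 81 * Q\<^sub>n P ^ 2 * ((alpha P)^2 + beta P * gamma P)"
    unfolding Q\<^sub>n_def[of "Psi P"] moment_Psi[OF assms] by algebra
  also have "\<dots> = 81 * Q\<^sub>n P ^ 3"
    unfolding Q\<^sub>n_def by algebra
  finally show ?thesis .
qed

text \<open>
  The outer \<open>\<Psi>\<close> acts through \<open>\<mu>(\<Psi>(P)) = -9 Q\<^sub>n(P) \<mu>(P)\<close>, so \<open>\<Psi>(\<Psi>(P))\<close> is \<open>-9 Q\<^sub>n(P)\<close> times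
  \<open>\<mu>(P) \<cdot> \<mu>(P) \<cdot> P = 9 Q\<^sub>n(P) P\<close>.
\<close>
lemma Psi_Psi:
  fixes P :: "'a::field poly poly"
  assumes "CHAR('a) \<noteq> 3" and "P \<in> binary_cubics"
  shows "Psi (Psi P) = const (- 81 * Q\<^sub>n P ^ 2) * P"
proof -
  let ?s = "- 81 * Q\<^sub>n P ^ 2"
  have coeffs:
    "cf_a (Psi (Psi P)) = ?s * cf_a P" "cf_b (Psi (Psi P)) = ?s * cf_b P"
    "cf_c (Psi (Psi P)) = ?s * cf_c P" "cf_d (Psi (Psi P)) = ?s * cf_d P"
    unfolding cf_Psi[OF assms(1), of "Psi P"] moment_Psi[OF assms(1)] cf_Psi[OF assms(1)]
    unfolding Q\<^sub>n_def alpha_def beta_def gamma_def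
    by algebra+
  have scaled: "const ?s * P \<in> binary_cubics"
    using assms(2) by (rule scale_in_binary_cubics)
  show ?thesis
    using binary_cubic_eq[OF assms(1) Psi_in_binary_cubics[of "Psi P"]]
      binary_cubic_eq[OF assms(1) scaled]
    unfolding coeffs cf_scale by (rule trans[OF _ sym])
qed

theorem proposition2p15:
  fixes P :: "'k::field poly poly"
  assumes "CHAR('k) \<noteq> 2" and "CHAR('k) \<noteq> 3"
    and "P \<in> binary_cubics"
    and "Q\<^sub>n P \<noteq> 0"
  shows "P \<in> Psi ` binary_cubics \<longleftrightarrow> (\<exists>t::'k. t \<noteq> 0 \<and> 9 * Q\<^sub>n P = t^3)"
proof
  assume "P \<in> Psi ` binary_cubics"
  then obtain R where P: "P = Psi R" by blast
  have Q: "Q\<^sub>n P = 81 * Q\<^sub>n R ^ 3"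
    unfolding P by (rule Qn_Psi[OF assms(2)])
  have "9 * Q\<^sub>n P = (9 * Q\<^sub>n R)^3"
    unfolding Q by algebra
  moreover have "9 * Q\<^sub>n R \<noteq> 0"
  proof
    assume zero: "9 * Q\<^sub>n R = 0"
    have "Q\<^sub>n P = (9 * Q\<^sub>n R)^2 * Q\<^sub>n R"
      unfolding Q by algebra
    also have "\<dots> = 0" unfolding zero by simp
    finally show False using assms(4) by contradiction
  qed
  ultimately show "\<exists>t. t \<noteq> 0 \<and> 9 * Q\<^sub>n P = t^3" by blast
next
  assume "\<exists>t::'k. t \<noteq> 0 \<and> 9 * Q\<^sub>n P = t^3"
  then obtain t :: 'k where t: "t \<noteq> 0" "9 * Q\<^sub>n P = t^3" by blast
  \<comment> \<open>A multiple \<open>l \<Psi>(P)\<close> is sent to \<open>-81 l\<^sup>3 Q\<^sub>n(P)\<^sup>2 P = -(l t\<^sup>2)\<^sup>3 P\<close>.\<close>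
  define l where "l = - inverse (t^2)"
  have "l^3 * (- 81 * Q\<^sub>n P ^ 2) = - (l^3 * (9 * Q\<^sub>n P)^2)" by algebra
  also have "\<dots> = - ((l * t^2)^3)" unfolding t(2) by algebra
  also have "l * t^2 = - 1" using t(1) by (simp add: l_def)
  finally have unit: "l^3 * (- 81 * Q\<^sub>n P ^ 2) = 1" by simp
  have "Psi (const l * Psi P) = const (l^3) * (const (- 81 * Q\<^sub>n P ^ 2) * P)"
    unfolding Psi_scale Psi_Psi[OF assms(2,3)] ..
  also have "\<dots> = const (l^3 * (- 81 * Q\<^sub>n P ^ 2)) * P" by simp
  also have "\<dots> = P" unfolding unit by (simp flip: one_pCons)
  finally have "Psi (const l * Psi P) = P" .
  moreover have "const l * Psi P \<in> binary_cubics"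
    by (rule scale_in_binary_cubics[OF Psi_in_binary_cubics])
  ultimately show "P \<in> Psi ` binary_cubics" by (metis imageI)
qed

end
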